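(* Let $n\ge2$ and let $I_n\subseteq SG$ be an $n$-interpolatory set. Then $I_n$ cannot contain the three edges of a cell together with $3n+1$ additional points (i.e. $3n+1$ distinct points not on those three edges). In particular, $I_n$ cannot contain a cell.
   Context: Sierpinski gasket: let $q_0=(\tfrac12,\tfrac{\sqrt3}{2})$, $q_1=(0,0)$, $q_2=(1,0)$, $V_0=\{q_0,q_1,q_2\}$, $F_i(x)=\tfrac12(x-q_i)+q_i$, and let $SG\subset\mathbb R^2$ be the unique nonempty compact set with $SG=\bigcup_{i=0}^2F_i(SG)$. For a word $w=(w_1,\dots,w_m)\in\{0,1,2\}^m$, $|w|=m$, put $F_w=F_{w_1}\circ\cdots\circ F_{w_m}$; a cell (an $m$-cell) is a set $F_w(SG)$, and its three edges are the straight segments joining the points $F_w(q_0),F_w(q_1),F_w(q_2)$ pairwise (they lie in $SG$). $V_m=\bigcup_{|w|=m}F_w(V_0)$; distinct $x,y\in V_m$ satisfy $x\sim_m y$ if they lie in a common $m$-cell. $\mu$ is the self-similar Borel probability measure with $\mu(F_w(SG))=3^{-|w|}$. All functions are real-valued. Energy and Laplacian: $\mathscr E(u,v)=\lim_{m\to\infty}(3/5)^{-m}\sum_{x\sim_m y}(u(x)-u(y))(v(x)-v(y))$ (sum over unordered pairs), and $u\in\operatorname{dom}\mathscr E$ if $\mathscr E(u,u)$ exists and is finite. For $u\in\operatorname{dom}\mathscr E$ and $f$ continuous, $\Delta u=f$ means $\mathscr E(u,v)=-\int_{SG}fv\,d\mu$ for all $v\in\operatorname{dom}\mathscr E$ vanishing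 on $V_0$. Indices of $q_i$ are mod 3. Normal derivative: $\partial_nu(q_i)=\lim_m(5/3)^m(2u(q_i)-u(F_i^mq_{i+1})-u(F_i^mq_{i-1}))$. Tangential derivative: $\partial_Tu(q_i)=\lim_m5^m(u(F_i^mq_{i+1})-u(F_i^mq_{i-1}))$. Monomials: for $j\ge0$, $k\in\{1,2,3\}$, $P_{j,k}$ is the unique (continuous) function with $\Delta^{j+1}P_{j,k}=0$ such that for all $0\le n\le j$: $\Delta^nP_{j,k}(q_0)=\delta_{nj}\delta_{k1}$, $\partial_n\Delta^nP_{j,k}(q_0)=\delta_{nj}\delta_{k2}$, $\partial_T\Delta^nP_{j,k}(q_0)=\delta_{nj}\delta_{k3}$. The functions $P_{j,k}$, $0\le j\le n$, $1\le k\le3$, form a basis of the $(3n+3)$-dimensional space $\mathcal H_n=\{u:\Delta^{n+1}u=0\}$. Interpolation: for distinct points $x_1,\dots,x_{3n+3}\in SG$, the interpolation matrix $M_n$ on $\{x_1,\dots,x_{3n+3}\}$ is the $(3n+3)\times(3n+3)$ matrix whose $i$-th row consists of the values $P_{j,k}(x_i)$, $0\le j\le n$, $1\le k\le 3$ (in a fixed order of the pairs $(j,k)$). A subset $I\subseteq SG$ is $n$-interpolatory if for every subset $N\subseteq I$ with $|N|=3n+3$ the matrix $M_n$ on $N$ is invertible. *)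

theory Defs
  imports "HOL-Probability.Probability_Measure" "Jordan_Normal_Form.Matrix"
begin

section \<open>The Sierpinski gasket\<close>

text \<open>The index type \<open>3\<close> is the type of integers mod 3, so \<open>i + 1\<close> and \<open>i - 1\<close> below are
  computed mod 3.\<close>

definition q :: "3 \<Rightarrow> real^2" where
  "q i = (if i = 0 then vector [1/2, sqrt 3 / 2]
          else if i = 1 then vector [0, 0]
          else vector [1, 0])"

definition F :: "3 \<Rightarrow> real^2 \<Rightarrow> real^2" where
  "F i x = (1/2) *\<^sub>R (x - q i) + q i"

primrec Fw :: "3 list \<Rightarrow> real^2 \<Rightarrow> real^2" where
  "Fw [] = id"
| "Fw (i # w) = F i \<circ> Fw w"

definition SG :: "(real^2) set" where
  "SG = (THE K. K \<noteq> {} \<and> compact K \<and> K = (\<Union>i. F i ` K))"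

definition cell :: "3 list \<Rightarrow> (real^2) set" where
  "cell w = Fw w ` SG"

definition cell_edges :: "3 list \<Rightarrow> (real^2) set" where
  "cell_edges w = (\<Union>i. closed_segment (Fw w (q i)) (Fw w (q (i + 1))))"

definition V :: "nat \<Rightarrow> (real^2) set" where
  "V m = (\<Union>w\<in>{w. length w = m}. Fw w ` range q)"

definition adjacent :: "nat \<Rightarrow> real^2 \<Rightarrow> real^2 \<Rightarrow> bool" where
  "adjacent m x y \<longleftrightarrow> x \<noteq> y \<and> x \<in> V m \<and> y \<in> V m \<and>
     (\<exists>w. length w = m \<and> x \<in> cell w \<and> y \<in> cell w)"

definition SG_measure :: "(real^2) measure" where
  "SG_measure = (THE M. prob_space M \<and> sets M = sets (restrict_space borel SG) \<and>
     (\<forall>w. measure M (cell w) = (1/3) ^ length w))"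


section \<open>Energy, Laplacian and boundary derivatives\<close>

text \<open>Functions on the gasket are represented by functions on the plane whose values outside
  \<open>SG\<close> are irrelevant.

  The sum over unordered pairs is half the sum over ordered pairs.\<close>

definition graph_energy :: "nat \<Rightarrow> (real^2 \<Rightarrow> real) \<Rightarrow> (real^2 \<Rightarrow> real) \<Rightarrow> real" where
  "graph_energy m u v = inverse ((3/5) ^ m) *
     ((\<Sum>(x, y)\<in>{(x, y). adjacent m x y}. (u x - u y) * (v x - v y)) / 2)"

definition energy :: "(real^2 \<Rightarrow> real) \<Rightarrow> (real^2 \<Rightarrow> real) \<Rightarrow> real" where
  "energy u v = lim (\<lambda>m. graph_energy m u v)"

text \<open>As usual, the energy domain consists of continuous functions; the energy only sees the
  values on the countable set of vertices, so without continuity the weak formulation of the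
  Laplacian below would be degenerate.\<close>

definition energy_dom :: "(real^2 \<Rightarrow> real) set" where
  "energy_dom = {u. continuous_on SG u \<and> convergent (\<lambda>m. graph_energy m u u)}"

definition has_laplacian :: "(real^2 \<Rightarrow> real) \<Rightarrow> (real^2 \<Rightarrow> real) \<Rightarrow> bool" where
  "has_laplacian u f \<longleftrightarrow> u \<in> energy_dom \<and> continuous_on SG f \<and>
     (\<forall>v\<in>energy_dom. (\<forall>x\<in>V 0. v x = 0) \<longrightarrow>
        energy u v = - (LINT x|SG_measure. f x * v x))"

definition has_normal_deriv :: "(real^2 \<Rightarrow> real) \<Rightarrow> 3 \<Rightarrow> real \<Rightarrow> bool" where
  "has_normal_deriv u i d \<longleftrightarrow>
     (\<lambda>m. (5/3) ^ m * (2 * u (q i) - u ((F i ^^ m) (q (i + 1))) - u ((F i ^^ m) (q (i - 1)))))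
       \<longlonglongrightarrow> d"

definition has_tangential_deriv :: "(real^2 \<Rightarrow> real) \<Rightarrow> 3 \<Rightarrow> real \<Rightarrow> bool" where
  "has_tangential_deriv u i d \<longleftrightarrow>
     (\<lambda>m. 5 ^ m * (u ((F i ^^ m) (q (i + 1))) - u ((F i ^^ m) (q (i - 1))))) \<longlonglongrightarrow> d"


section \<open>Monomials and interpolation\<close>

text \<open>The sequence \<open>g\<close> consists of the iterated Laplacians: \<open>g m\<close> is $\Delta^m u$. These are
  determined by \<open>u\<close> on \<open>SG\<close>.\<close>

definition is_monomial :: "nat \<Rightarrow> nat \<Rightarrow> (real^2 \<Rightarrow> real) \<Rightarrow> bool" where
  "is_monomial j k u \<longleftrightarrow> (\<exists>g :: nat \<Rightarrow> real^2 \<Rightarrow> real.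
     g 0 = u \<and>
     (\<forall>m\<le>j. has_laplacian (g m) (g (Suc m))) \<and>
     (\<forall>x\<in>SG. g (Suc j) x = 0) \<and>
     (\<forall>m\<le>j. g m (q 0) = of_bool (m = j \<and> k = 1) \<and>
            has_normal_deriv (g m) 0 (of_bool (m = j \<and> k = 2)) \<and>
            has_tangential_deriv (g m) 0 (of_bool (m = j \<and> k = 3))))"

text \<open>\<open>P j k\<close> is $P_{j,k}$; this fixes each \<open>P j k\<close>, \<open>1 \<le> k \<le> 3\<close>, uniquely on \<open>SG\<close>.\<close>

definition is_monomial_family :: "(nat \<Rightarrow> nat \<Rightarrow> real^2 \<Rightarrow> real) \<Rightarrow> bool" where
  "is_monomial_family P \<longleftrightarrow> (\<forall>j. \<forall>k\<in>{1..3}. is_monomial j k (P j k))"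

text \<open>Column \<open>c\<close> belongs to the pair \<open>(j, k) = (c div 3, c mod 3 + 1)\<close>.\<close>

definition interp_matrix ::
    "(nat \<Rightarrow> nat \<Rightarrow> real^2 \<Rightarrow> real) \<Rightarrow> nat \<Rightarrow> (real^2) list \<Rightarrow> real mat" where
  "interp_matrix P n xs =
     mat (3 * n + 3) (3 * n + 3) (\<lambda>(r, c). P (c div 3) (c mod 3 + 1) (xs ! r))"

text \<open>The list \<open>xs\<close> enumerates \<open>N\<close>; invertibility does not depend on its order.\<close>

definition interpolatory ::
    "(nat \<Rightarrow> nat \<Rightarrow> real^2 \<Rightarrow> real) \<Rightarrow> nat \<Rightarrow> (real^2) set \<Rightarrow> bool" where
  "interpolatory P n I \<longleftrightarrow> I \<subseteq> SG \<and>
     (\<forall>N xs. N \<subseteq> I \<and> card N = 3 * n + 3 \<and> distinct xs \<and> set xs = N \<longrightarrow>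
        invertible_mat (interp_matrix P n xs))"

end

theory Submission
  imports Defs "Jordan_Normal_Form.Determinant"
begin

text \<open>The argument is that of the Mairhuber--Curtis theorem and uses only the continuity of the
  \<open>P j k\<close>. Fix $3n+1$ points off the three edges and let two further points move on the boundary
  triangle. They can exchange places without ever meeting, and the interpolation determinant
  changes sign when they are exchanged, so it vanishes on the way. For the statement about
  cells, \<open>SG\<close> contains infinitely many points off the triangle of \<open>V 0\<close>, such as those of the
  segment joining the midpoints of two of its sides.\<close>

section \<open>The gasket as an attractor\<close>

lemma F_alt: "F i x = (1/2) *\<^sub>R q i + (1/2) *\<^sub>R x"
proof -
  have "q i = (1/2) *\<^sub>R q i + (1/2) *\<^sub>R q i"
    by (simp flip: scaleR_left.add)
  then show ?thesis
    unfolding F_def by (simp add: algebra_simps)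
qed

lemma F_q [simp]: "F i (q i) = q i"
  by (simp add: F_def)

lemma dist_F: "dist (F i x) (F i y) = dist x y / 2"
  by (simp add: F_alt dist_norm flip: scaleR_diff_right)

lemma inj_F: "inj (F i)"
  by (auto simp: F_alt inj_def)

lemma F_convex_comb:
  "F i ((1 - u) *\<^sub>R a + u *\<^sub>R b) = (1 - u) *\<^sub>R F i a + u *\<^sub>R F i b"
  by (simp add: F_alt Finite_Cartesian_Product.vec_eq_iff field_simps)

lemma closed_segment_F: "closed_segment (F i a) (F i b) = F i ` closed_segment a b"
  by (auto simp: closed_segment_def F_convex_comb[symmetric])

lemma open_segment_F: "open_segment (F i a) (F i b) = F i ` open_segment a b"
  using inj_F[of i] by (auto simp: open_segment_def closed_segment_F inj_def)

lemma closure_F: "closure (F i ` S) = F i ` closure S"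
proof -
  have *: "F i ` T = (+) ((1/2) *\<^sub>R q i) ` ((*\<^sub>R) (1/2) ` T)" for T
    by (auto simp: F_alt image_iff)
  show ?thesis
    by (simp only: * closure_translation closure_scaleR)
qed

text \<open>The maximum over \<open>L\<close> of the distance to \<open>K\<close> is attained at a
  point \<open>F i y\<close> with \<open>y \<in> L\<close>. As \<open>F i\<close> halves distances
  and maps \<open>K\<close> into itself, this maximum is at most half of itself, hence 0. This gives
  both the uniqueness of the attractor and a criterion for a compact set to lie in
  \<open>SG\<close>.\<close>

lemma subset_of_invariant:
  assumes L: "compact L" "L \<subseteq> (\<Union>i. F i ` L)"
    and K: "closed K" "K \<noteq> {}" "(\<Union>i. F i ` K) \<subseteq> K"
  shows "L \<subseteq> K"
proof (cases "L = {}")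
  case False
  have "continuous_on L (\<lambda>x. infdist x K)"
    by (intro continuous_intros)
  from continuous_attains_sup[OF L(1) False this]
  obtain x where x: "x \<in> L" "\<And>y. y \<in> L \<Longrightarrow> infdist y K \<le> infdist x K"
    by blast
  then obtain i y where y: "y \<in> L" "x = F i y"
    using L(2) by auto
  obtain z where z: "z \<in> K" "infdist y K = dist y z"
    using infdist_attains_inf[OF K(1,2)] by blast
  have "infdist x K \<le> dist x (F i z)"
    using z(1) K(3) by (intro infdist_le) auto
  also have "\<dots> = infdist y K / 2"
    by (simp add: y z dist_F)
  also have "\<dots> \<le> infdist x K / 2"
    using x(2)[OF y(1)] by simp
  finally have "infdist x K = 0"
    using infdist_nonneg[of x K] by linarith
  then have "infdist y K = 0" if "y \<in> L" for y
    using x(2)[OF that] infdist_nonneg[of y K] by linarith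
  then show ?thesis
    using in_closed_iff_infdist_zero[OF K(1,2)] by auto
qed auto

lemma numerals_mod_3: "(3 :: 3) = 0" "(4 :: 3) = 1"
  by simp_all

lemma UNIV_3': "(UNIV :: 3 set) = {0, 1, 2}"
  using UNIV_3 numerals_mod_3(1) by auto

text \<open>Needed to unfold the definite description in \<open>SG\<close>. The attractor is
  obtained as the closure of the orbit of the three vertices.\<close>

lemma ex1_attractor: "\<exists>!K. K \<noteq> {} \<and> compact K \<and> K = (\<Union>i. F i ` K)"
proof (rule ex_ex1I)
  define B where "B = (\<Union>w. Fw w ` range q)"
  have Fw_mem: "F i (Fw w (q j)) \<in> B" for i w j
    unfolding B_def using Fw.simps(2)[of i w] by (metis UNIV_I UN_iff comp_apply imageI)
  have "x \<in> (\<Union>i. F i ` B)" if x_mem: "x \<in> B" for x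
  proof -
    obtain w j where x: "x = Fw w (q j)"
      using x_mem by (auto simp: B_def)
    have base: "Fw v (q j) \<in> B" for v
      by (auto simp: B_def)
    show ?thesis
    proof (cases w)
      case Nil
      \<comment> \<open>A vertex has no first letter to split off, but it is the fixed point of its
        own map.\<close>
      then have "x = F j (Fw [] (q j))"
        by (simp add: x)
      then show ?thesis
        using base by blast
    next
      case (Cons i v)
      then have "x = F i (Fw v (q j))"
        by (simp add: x)
      then show ?thesis
        using base by blast
    qed
  qed
  moreover have "F i ` B \<subseteq> B" for i
    using Fw_mem by (auto simp: B_def)
  ultimately have B: "B = (\<Union>i. F i ` B)"
    by blast
  \<comment> \<open>Each \<open>F i\<close> averages its argument with \<open>q i\<close>, so it
    preserves any ball around the origin that contains all the vertices.\<close>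
  have bound: "norm (Fw w (q j)) \<le> (\<Sum>i\<in>UNIV. norm (q i))" (is "_ \<le> ?C") for w j
  proof (induction w)
    case Nil
    show ?case
      using member_le_sum[of j UNIV "\<lambda>i. norm (q i)"] by simp
  next
    case (Cons i w)
    have "norm (Fw (i # w) (q j)) \<le> norm (q i) / 2 + norm (Fw w (q j)) / 2"
      using norm_triangle_ineq[of "(1/2) *\<^sub>R q i" "(1/2) *\<^sub>R Fw w (q j)"] by (simp add: F_alt)
    also have "\<dots> \<le> ?C"
      using Cons member_le_sum[of i UNIV "\<lambda>i. norm (q i)"] by simp
    finally show ?case .
  qed
  have "bounded B"
    unfolding bounded_iff B_def using bound by blast
  then have "compact (closure B)"
    by (simp add: compact_closure)
  \<comment> \<open>Closure commutes with the union because there are only three maps.\<close>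
  moreover have "closure B = (\<Union>i. F i ` closure B)"
    by (subst B) (simp add: UNIV_3' closure_F)
  moreover have "closure B \<noteq> {}"
    by (auto simp: B_def)
  ultimately show "\<exists>K. K \<noteq> {} \<and> compact K \<and> K = (\<Union>i. F i ` K)"
    by blast
next
  fix K L
  assume "K \<noteq> {} \<and> compact K \<and> K = (\<Union>i. F i ` K)" "L \<noteq> {} \<and> compact L \<and> L = (\<Union>i. F i ` L)"
  then show "K = L"
    using subset_of_invariant[of K L] subset_of_invariant[of L K] compact_imp_closed
    by blast
qed

lemma SG_nonempty: "SG \<noteq> {}"
  and compact_SG: "compact SG"
  and SG_self_similar: "SG = (\<Union>i. F i ` SG)"
  using theI'[OF ex1_attractor] unfolding SG_def[symmetric] by auto

lemma F_in_SG: "x \<in> SG \<Longrightarrow> F i x \<in> SG"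
  using SG_self_similar by blast

text \<open>The maps \<open>F i\<close> and \<open>F j\<close> send the segment onto its two halves,
  so it is covered by its own images and \<open>subset_of_invariant\<close> applies.\<close>

lemma edge_subset_SG: "closed_segment (q i) (q j) \<subseteq> SG"
proof (rule subset_of_invariant)
  define m where "m = midpoint (q i) (q j)"
  have m: "F i (q j) = m" "F j (q i) = m"
    by (simp_all add: m_def midpoint_def F_alt algebra_simps)
  have "closed_segment (q i) (q j) = closed_segment (q i) m \<union> closed_segment m (q j)"
    by (rule Un_closed_segment[symmetric]) (simp add: m_def)
  also have "\<dots> = F i ` closed_segment (q i) (q j) \<union> F j ` closed_segment (q i) (q j)"
    unfolding closed_segment_F[symmetric] by (simp add: m)
  finally show "closed_segment (q i) (q j) \<subseteq> (\<Union>k. F k ` closed_segment (q i) (q j))"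
    by blast
qed (use SG_nonempty compact_SG compact_imp_closed F_in_SG in auto)

section \<open>Points of a cell off its edges\<close>

lemma q_coords:
  "q 0 $ 1 = 1/2" "q 0 $ 2 = sqrt 3 / 2" "q 1 $ 1 = 0" "q 1 $ 2 = 0" "q 2 $ 1 = 1" "q 2 $ 2 = 0"
  by (simp_all add: q_def)

lemma inj_q: "inj q"
proof (rule injI)
  fix i j assume eq: "q i = q j"
  have "i \<in> {0, 1, 2}" "j \<in> {0, 1, 2}"
    using UNIV_3' by auto
  moreover have "q i $ 1 = q j $ 1"
    using eq by simp
  ultimately show "i = j"
    by (auto simp: q_coords)
qed

text \<open>The image lies at height \<open>sqrt 3 / 4\<close> with abscissa strictly between 1/4
  and 3/4. At that height the two slanted sides have abscissa exactly 1/4 and 3/4, and the base has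
  height 0.\<close>

lemma inner_segment_disjoint_edges: "F 0 ` open_segment (q 1) (q 2) \<inter> cell_edges [] = {}"
proof -
  have False if z: "z \<in> F 0 ` open_segment (q 1) (q 2)" "z \<in> cell_edges []" for z
  proof -
    obtain t where t: "0 < t" "t < 1" "z = F 0 ((1 - t) *\<^sub>R q 1 + t *\<^sub>R q 2)"
      using z(1) by (auto simp: in_segment)
    have z1: "z $ 1 = 1/4 + t/2" and z2: "z $ 2 = sqrt 3 / 4"
      by (simp_all add: t F_alt q_coords)
    have "z \<in> closed_segment (q 0) (q 1) \<union> closed_segment (q 1) (q 2) \<union> closed_segment (q 2) (q 0)"
      using z(2) by (auto simp: cell_edges_def UNIV_3' numerals_mod_3)
    then consider "z \<in> closed_segment (q 0) (q 1)" | "z \<in> closed_segment (q 1) (q 2)"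
      | "z \<in> closed_segment (q 2) (q 0)" by blast
    then show False
    proof cases
      case 1
      then obtain u where u: "z = (1 - u) *\<^sub>R q 0 + u *\<^sub>R q 1"
        by (auto simp: in_segment)
      have "z $ 2 = sqrt 3 * z $ 1"
        unfolding u by (simp add: q_coords algebra_simps)
      then show False
        using t(1) by (simp add: z1 z2)
    next
      case 2
      then obtain u where "z = (1 - u) *\<^sub>R q 1 + u *\<^sub>R q 2"
        by (auto simp: in_segment)
      then have "z $ 2 = 0"
        by (simp add: q_coords)
      then show False
        by (simp add: z2)
    next
      case 3
      then obtain u where u: "z = (1 - u) *\<^sub>R q 2 + u *\<^sub>R q 0"
        by (auto simp: in_segment)
      have "z $ 2 = sqrt 3 * (1 - z $ 1)"
        unfolding u by (simp add: q_coords algebra_simps)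
      then have "sqrt 3 * (1/4) = sqrt 3 * (1 - (1/4 + t/2))"
        by (simp add: z1 z2)
      then have "1/4 = 1 - (1/4 + t/2)"
        by (subst (asm) mult_left_cancel) simp_all
      then show False
        using t(2) by simp
    qed
  qed
  then show ?thesis
    by blast
qed

lemma infinite_SG_minus_edges: "infinite (SG - cell_edges [])"
proof -
  have "infinite (F 0 ` open_segment (q 1) (q 2))"
    by (simp add: finite_image_iff inj_on_subset[OF inj_F] inj_eq[OF inj_q])
  moreover have "F 0 ` open_segment (q 1) (q 2) \<subseteq> SG - cell_edges []"
    using inner_segment_disjoint_edges edge_subset_SG[of 1 2] segment_open_subset_closed F_in_SG
    by blast
  ultimately show ?thesis
    using finite_subset by blast
qed

lemma inj_Fw: "inj (Fw w)"
  by (induction w) (simp_all add: inj_compose inj_F del: o_apply)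

lemma closed_segment_Fw: "closed_segment (Fw w a) (Fw w b) = Fw w ` closed_segment a b"
  by (induction w) (simp_all add: closed_segment_F image_comp)

lemma cell_edges_eq: "cell_edges w = Fw w ` cell_edges []"
  by (simp add: cell_edges_def closed_segment_Fw image_UN)

lemma cell_edges_subset_cell: "cell_edges w \<subseteq> cell w"
  unfolding cell_edges_eq[of w] cell_def
  using edge_subset_SG by (intro image_mono) (auto simp: cell_edges_def)

text \<open>The injective map \<open>Fw w\<close> transports the case of the empty word.\<close>

lemma infinite_cell_minus_edges: "infinite (cell w - cell_edges w)"
proof -
  have "cell w - cell_edges w = Fw w ` (SG - cell_edges [])"
    unfolding cell_edges_eq[of w] cell_def using inj_Fw by (simp add: image_set_diff)
  then show ?thesis
    using infinite_SG_minus_edges inj_Fw by (metis finite_imageD inj_on_subset subset_UNIV)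
qed

section \<open>Exchanging two points on a triangle\<close>

lemma same_sign_on_connected:
  fixes f :: "'a::topological_space \<Rightarrow> real"
  assumes "connected S" "continuous_on S f" "\<And>x. x \<in> S \<Longrightarrow> f x \<noteq> 0" "a \<in> S" "b \<in> S"
  shows "0 < f a \<longleftrightarrow> 0 < f b"
proof -
  have "connected (f ` S)"
    using assms by (simp add: connected_continuous_image)
  moreover have "0 \<notin> f ` S"
    using assms(3) by auto
  ultimately show ?thesis
    using assms(4,5) connectedD_interval[of "f ` S" "f a" "f b" 0]
      connectedD_interval[of "f ` S" "f b" "f a" 0]
    by fastforce
qed

text \<open>The two points \<open>a\<close>, \<open>b\<close> are exchanged in three moves of a single point along the side
  opposite to the other one; by antisymmetry the moving point may always be written second.\<close>

lemma antisymmetric_vanishes_on_triangle: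
  fixes D :: "'a::real_normed_vector \<Rightarrow> 'a \<Rightarrow> real" and p :: "3 \<Rightarrow> 'a"
  assumes cont: "\<And>i. continuous_on (closed_segment (p (i + 1)) (p (i + 2))) (D (p i))"
    and antisym: "\<And>i j. D (p i) (p j) = - D (p j) (p i)"
  obtains i y where "y \<in> closed_segment (p (i + 1)) (p (i + 2))" "D (p i) y = 0"
proof (rule ccontr)
  assume "\<not> thesis"
  with that have nz: "y \<in> closed_segment (p (i + 1)) (p (i + 2)) \<Longrightarrow> D (p i) y \<noteq> 0" for i y
    by blast
  have move: "0 < D (p i) (p (i + 1)) \<longleftrightarrow> 0 < D (p i) (p (i + 2))" for i
    by (rule same_sign_on_connected[OF connected_segment(1) cont]) (use nz in auto)
  \<comment> \<open>With these, failing to be positive means being negative.\<close>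
  have "D (p 0) (p 1) \<noteq> 0" "D (p 1) (p 2) \<noteq> 0" "D (p 2) (p 0) \<noteq> 0"
    using nz[of "p 1" 0] nz[of "p 2" 1] nz[of "p 0" 2] by (simp_all add: numerals_mod_3)
  \<comment> \<open>Going once round, the three moves keep the sign and the three uses of
    antisymmetry reverse it, so \<open>D (p 0) (p 1)\<close> would have the sign opposite to its
    own.\<close>
  then show False
    using move[of 0] move[of 1] move[of 2] antisym[of 0 1] antisym[of 1 2] antisym[of 2 0]
    by (simp add: numerals_mod_3) linarith
qed

section \<open>The interpolation determinant\<close>

lemma continuous_on_monomial:
  assumes "is_monomial_family P" "k \<in> {1..3}"
  shows "continuous_on SG (P j k)"
proof -
  have "is_monomial j k (P j k)"
    using assms by (auto simp: is_monomial_family_def)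
  then obtain g where "g 0 = P j k" "has_laplacian (g 0) (g (Suc 0))"
    unfolding is_monomial_def by blast
  then show ?thesis
    by (simp add: has_laplacian_def energy_dom_def)
qed

text \<open>The Leibniz formula makes the determinant a polynomial in the entries; those of row
  \<open>i\<close> are monomials evaluated at \<open>y\<close>, and all others are constant in
  \<open>y\<close>.\<close>

lemma continuous_on_det_interp_matrix:
  assumes P: "is_monomial_family P" and S: "S \<subseteq> SG"
  shows "continuous_on S (\<lambda>y. Determinant.det (interp_matrix P n (xs[i := y])))"
proof -
  let ?m = "3 * n + 3"
  have entry: "continuous_on S (\<lambda>y. P (c div 3) (c mod 3 + 1) (xs[i := y] ! r))" for c r
  proof (cases "r = i \<and> i < length xs")
    case True
    moreover have "continuous_on S (P (c div 3) (c mod 3 + 1))"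
      by (rule continuous_on_subset[OF continuous_on_monomial[OF P] S]) auto
    ultimately show ?thesis
      by simp
  next
    \<comment> \<open>This includes an index \<open>i\<close> beyond the end of the list, where the
      update changes nothing.\<close>
    case False
    then have "xs[i := y] ! r = xs ! r" for y
      by (cases "i < length xs") (auto simp: list_update_beyond)
    then show ?thesis
      by simp
  qed
  have "Determinant.det (interp_matrix P n (xs[i := y])) =
      (\<Sum>\<sigma> | \<sigma> permutes {0..<?m}. signof \<sigma> *
        (\<Prod>r = 0..<?m. P (\<sigma> r div 3) (\<sigma> r mod 3 + 1) (xs[i := y] ! r)))" for y
  proof -
    have "interp_matrix P n (xs[i := y]) \<in> carrier_mat ?m ?m"
      by (simp add: interp_matrix_def)
    then show ?thesis
      by (subst det_def', assumption) (intro sum.cong arg_cong2[of _ _ _ _ "(*)"] prod.cong refl,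
          auto simp: interp_matrix_def dest: permutes_in_image)
  qed
  then show ?thesis
    by (simp only:) (intro continuous_intros entry)
qed

lemma det_interp_matrix_swap:
  "Determinant.det (interp_matrix P n (x # y # as)) =
    - Determinant.det (interp_matrix P n (y # x # as))"
proof -
  have *: "interp_matrix P n (x # y # as) = swaprows 0 1 (interp_matrix P n (y # x # as))"
    by (rule eq_matI) (auto simp: interp_matrix_def nth_Cons')
  show ?thesis
    unfolding * by (rule det_swaprows[of 0 "3 * n + 3"]) (auto simp: interp_matrix_def)
qed

lemma invertible_mat_det_nonzero:
  fixes M :: "'a :: idom mat"
  assumes "invertible_mat M"
  shows "Determinant.det M \<noteq> 0"
proof -
  define m where "m = dim_row M"
  obtain B where B: "M * B = 1\<^sub>m m" "B * M = 1\<^sub>m (dim_row B)" and sq: "dim_col M = m"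
    using assms by (auto simp: invertible_mat_def inverts_mat_def m_def)
  \<comment> \<open>The size of the inverse is read off by comparing the column counts in the two
    products.\<close>
  have "dim_col B = m" "dim_row B = m"
    using arg_cong[OF B(1), of dim_col] arg_cong[OF B(2), of dim_col] sq by auto
  then have "M \<in> carrier_mat m m" "B \<in> carrier_mat m m"
    using sq by (auto simp: m_def)
  then have "Determinant.det M * Determinant.det B = 1"
    using B(1) by (metis det_mult det_one)
  then show ?thesis
    by auto
qed

lemma det_interp_matrix_nonzero:
  assumes "interpolatory P n I" "distinct xs" "set xs \<subseteq> I" "length xs = 3 * n + 3"
  shows "Determinant.det (interp_matrix P n xs) \<noteq> 0"
proof -
  have "invertible_mat (interp_matrix P n xs)"
    using assms by (auto simp: interpolatory_def distinct_card)
  then show ?thesis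
    by (rule invertible_mat_det_nonzero)
qed

text \<open>With the points of \<open>A\<close> fixed, two points on the triangle complete a list of
  \<open>3 * n + 3\<close>. The condition \<open>apex\<close> keeps these two apart when one is a
  corner and the other moves along the opposite side, and disjointness from the sides keeps both out
  of \<open>A\<close>, so the determinant can never vanish.\<close>

lemma interpolatory_no_triangle:
  fixes p :: "3 \<Rightarrow> real^2"
  assumes P: "is_monomial_family P" and I: "interpolatory P n I"
    and edges: "\<And>i. closed_segment (p i) (p (i + 1)) \<subseteq> I"
    and apex: "\<And>i. p i \<notin> closed_segment (p (i + 1)) (p (i + 2))"
    and A: "A \<subseteq> I" "\<And>i. A \<inter> closed_segment (p i) (p (i + 1)) = {}"
  shows "card A \<noteq> 3 * n + 1"
proof
  assume card: "card A = 3 * n + 1"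
  \<comment> \<open>An infinite set has \<open>card\<close> 0, which differs from
    \<open>3 * n + 1\<close>.\<close>
  then have "finite A"
    using card.infinite by force
  then obtain as where as: "set as = A" "distinct as"
    using finite_distinct_list by blast
  then have len: "length as = 3 * n + 1"
    using card distinct_card by metis
  define D where "D x y = Determinant.det (interp_matrix P n (x # y # as))" for x y
  have side: "closed_segment (p (i + 1)) (p (i + 2)) \<subseteq> I"
    "A \<inter> closed_segment (p (i + 1)) (p (i + 2)) = {}" for i
    using edges[of "i + 1"] A(2)[of "i + 1"] by (simp_all add: add.assoc)
  have "I \<subseteq> SG"
    using I by (simp add: interpolatory_def)
  have "continuous_on (closed_segment (p (i + 1)) (p (i + 2))) (D (p i))" for i
    \<comment> \<open>The entry \<open>undefined\<close> is a placeholder, overwritten by the update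
      at position 1.\<close>
    using continuous_on_det_interp_matrix[OF P order_trans[OF side(1) \<open>I \<subseteq> SG\<close>],
        of i n "p i # undefined # as" 1]
    by (simp add: D_def[abs_def])
  moreover have "D (p i) (p j) = - D (p j) (p i)" for i j
    unfolding D_def by (rule det_interp_matrix_swap)
  ultimately obtain i y where y: "y \<in> closed_segment (p (i + 1)) (p (i + 2))" "D (p i) y = 0"
    using antisymmetric_vanishes_on_triangle by blast
  have "p i \<in> I" "p i \<notin> A" "y \<in> I" "y \<notin> A" "p i \<noteq> y"
    using edges[of i] A(2)[of i] side[of i] y(1) apex[of i] by auto
  then have "D (p i) y \<noteq> 0"
    unfolding D_def using as len A(1) by (intro det_interp_matrix_nonzero[OF I]) auto
  with y(2) show False
    by simp
qed

lemma q_not_in_opposite_edge: "q i \<notin> closed_segment (q (i + 1)) (q (i + 2))"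
proof -
  have "i \<in> {0, 1, 2}"
    using UNIV_3' by auto
  moreover have "q 0 \<notin> closed_segment (q 1) (q 2)"
    "q 1 \<notin> closed_segment (q 2) (q 0)" "q 2 \<notin> closed_segment (q 0) (q 1)"
    by (auto simp: in_segment Finite_Cartesian_Product.vec_eq_iff forall_2 q_coords)
  ultimately show ?thesis
    by (auto simp: numerals_mod_3)
qed

theorem proposition4p1:
  fixes P :: "nat \<Rightarrow> nat \<Rightarrow> real^2 \<Rightarrow> real" and n :: nat and I :: "(real^2) set"
  assumes "is_monomial_family P"
    and "n \<ge> 2"
    and "interpolatory P n I"
  shows "(\<nexists>w A. cell_edges w \<subseteq> I \<and> A \<subseteq> I \<and> A \<inter> cell_edges w = {} \<and> card A = 3 * n + 1) \<and>
         (\<nexists>w. cell w \<subseteq> I)"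
proof -
  have no_edges: "card A \<noteq> 3 * n + 1"
    if "cell_edges w \<subseteq> I" "A \<subseteq> I" "A \<inter> cell_edges w = {}" for w A
  proof (rule interpolatory_no_triangle[OF assms(1,3), where p = "\<lambda>i. Fw w (q i)"])
    \<comment> \<open>Nondegeneracy of the triangle passes to the cell because \<open>Fw w\<close>
      is injective and maps segments onto segments.\<close>
    show "Fw w (q i) \<notin> closed_segment (Fw w (q (i + 1))) (Fw w (q (i + 2)))" for i
      using q_not_in_opposite_edge[of i] inj_Fw
      by (simp add: closed_segment_Fw inj_image_mem_iff)
    show "closed_segment (Fw w (q i)) (Fw w (q (i + 1))) \<subseteq> I" for i
      using that(1) by (auto simp: cell_edges_def)
    show "A \<inter> closed_segment (Fw w (q i)) (Fw w (q (i + 1))) = {}" for i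
      using that(3) unfolding cell_edges_def by blast
  qed (fact that(2))
  have "\<not> cell w \<subseteq> I" for w
  proof
    assume "cell w \<subseteq> I"
    \<comment> \<open>A cell supplies the additional points itself.\<close>
    moreover obtain A where "card A = 3 * n + 1" "A \<subseteq> cell w - cell_edges w"
      using infinite_arbitrarily_large[OF infinite_cell_minus_edges] by blast
    ultimately show False
      using no_edges[of w A] cell_edges_subset_cell[of w] by blast
  qed
  with no_edges show ?thesis
    by blast
qed

end
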